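(* In the bipartite agent–item setting described in the context, let $\mathcal{F}_{A,E}=(E,\mathcal{I}_A)$ be the combination of the systems $(E_{A,j},\mathcal{I}_{A,j})$, $j\in[M_A]$, where each $(E_{A,j},\mathcal{I}_{A,j})$ is a $k_j$-growth system, and let $\mathcal{F}_{B,E}=(E,\mathcal{I}_B)$ be the combination of the systems $(E_{B,j},\mathcal{I}_{B,j})$, $j\in[M_B]$, where each $(E_{B,j},\mathcal{I}_{B,j})$ is an $\ell_j$-growth system. Let $\mathcal{F}=(E,\mathcal{I})$ with $\mathcal{I}=\mathcal{I}_A\cap\mathcal{I}_B$, and $$\mathrm{Core}(X)=\bigcap_{j=1}^{M_A}\big((X\setminus E_{A,j})\cup\mathrm{PCore}_{j,A}(X\cap E_{A,j})\big)\cap\bigcap_{j=1}^{M_B}\big((X\setminus E_{B,j})\cup\mathrm{PCore}_{j,B}(X\cap E_{B,j})\big)$$ for $X\subseteq E$, where $\mathrm{PCore}_{j,A}$ and $\mathrm{PCore}_{j,B}$ are the primitive core functions of $(E_{A,j},\mathcal{I}_{A,j})$ and $(E_{B,j},\mathcal{I}_{B,j})$. Let $$k=\max_{e\in E}\Big(\sum_{j:\,e\in E_{A,j}}k_j+\sum_{j:\,e\in E_{B,j}}\ell_j\Big),$$ and let $Y=Y(p)\subseteq A$ be a random set containing each agent $a\in A$ independently with probability $p$, for some $p\in(0,1]$. Then $$\mathbb{E}\big[w(\mathrm{Core}(\mathrm{Rel}(Y)))\big]\ \ge\ \frac{(p-(1-p)k)(1-p)}{p^2}\ \mathbb{E}\big[w(\mathrm{Greedy}(\delta(Y)))\big].$$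 Furthermore, if all components are matroids (i.e. $\mathcal{F}$ is a $k$-matchoid, with all $k_j=\ell_j=1$), then $$\mathbb{E}\big[w(\mathrm{Core}(\mathrm{Rel}(Y)))\big]\ \ge\ \frac{(p-(1-p)(k-1))(1-p)}{p}\ \mathbb{E}\big[w(\mathrm{Greedy}(\delta(Y)))\big].$$
   Context: An independence system $(S,\mathcal{I})$ is a finite set $S$ with a nonempty downward-closed family $\mathcal{I}\subseteq 2^S$ of independent sets; circuits are minimal non-independent sets; a basis of $X\subseteq S$ is a maximal independent subset of $X$. The combination of $(S_j,\mathcal{I}_j)$, $j\in[M]$, is $(S,\mathcal{I})$ with $S=\bigcup_jS_j$, $\mathcal{I}=\{I\subseteq S: I\cap S_j\in\mathcal{I}_j\ \forall j\}$. $(S,\mathcal{I})$ is a $k$-growth system ($k$ a positive integer) if for all $X\subseteq S$, $I\in\mathcal{I}$ there is a partition $(Q,Z)$ of $I\setminus X$ with $|Z|\le k|X\setminus I|$ such that $P\cup Q\in\mathcal{I}$ for every basis $P$ of $X$. (The 1-growth systems are exactly matroids.) Write $X+e=X\cup\{e\}$, $w(X)=\sum_{x\in X}w(x)$. Setting: $G=(A\cup B,E)$ is a finite bipartite graph (agents $A$, items $B$), $w:E\to\mathbb{R}_{\ge0}$ is injective, and $\delta(v)$, $\delta(Y)$ denote the sets of edges incident to a vertex $v$, resp. to a vertex set $Y\subseteq A$. The agent-side constraint is a combination $\mathcal{F}_A$ on $A$ of systems $(A_j,\mathcal{J}_j)$, $j\in[M_A]$, and the item-side constraint is a combination $\mathcal{F}_B$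 on $B$ of systems $(B_j,\mathcal{L}_j)$, $j\in[M_B]$ (so $A=\bigcup_jA_j$, $B=\bigcup_jB_j$). They are transferred to edges, treating all edges at the same agent (resp. item) as parallel copies: $E_{A,j}$ is the set of edges incident to $A_j$, and $\mathcal{I}_{A,j}$ consists of the sets $X\subseteq E_{A,j}$ such that each agent is incident to at most one edge of $X$ and the set of agents incident to $X$ belongs to $\mathcal{J}_j$; likewise $E_{B,j}$ is the set of edges incident to $B_j$, and $\mathcal{I}_{B,j}$ consists of the $X\subseteq E_{B,j}$ such that each item is incident to at most one edge of $X$ and the set of items incident to $X$ belongs to $\mathcal{L}_j$. Primitive hull and core of an independence system $(S,\mathcal{I})$: $\mathrm{PHull}(X)=X\cup\{e\in S:e\text{ belongs to some circuit contained in }X+e\}$ and $\mathrm{PCore}(X)=\{e\in X:e\notin\mathrm{PHull}(\{f\in X:w(f)>w(e)\})\}$. $\mathrm{Greedy}(X)$ for $X\subseteq E$: process the edges of $X$ in decreasing order of $w$, starting from $\emptyset$, adding an edge whenever the current set stays in $\mathcal{I}$; $\mathrm{Greedy}(X)$ is the final set. An edge $e\notin X$ is greedy-relevant with respect to $X$ if $e\in\mathrm{Greedy}(X+e)$. For $Y\subseteq A$ and $a\in A\setminus Y$, the top-relevant edge of $a$ is the heaviest edge in $\delta(a)$ that is greedy-relevant with respect to $\delta(Y)$ (if any exists). $\mathrm{Rel}(Y)\subseteq E$ is the set of top-relevant edges of all agents $a\in A\setminus Y$ having one. *)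

theory Defs
  imports "HOL-Probability.Probability"
begin

definition indep_system :: "'e set \<Rightarrow> 'e set set \<Rightarrow> bool" where
  "indep_system S I \<longleftrightarrow>
     finite S \<and> I \<subseteq> Pow S \<and> I \<noteq> {} \<and> (\<forall>X\<in>I. \<forall>Y. Y \<subseteq> X \<longrightarrow> Y \<in> I)"

definition circuit :: "'e set \<Rightarrow> 'e set set \<Rightarrow> 'e set \<Rightarrow> bool" where
  "circuit S I C \<longleftrightarrow> C \<subseteq> S \<and> C \<notin> I \<and> (\<forall>D. D \<subset> C \<longrightarrow> D \<in> I)"

definition basis_of :: "'e set set \<Rightarrow> 'e set \<Rightarrow> 'e set \<Rightarrow> bool" where
  "basis_of I X P \<longleftrightarrow> P \<in> I \<and> P \<subseteq> X \<and> (\<forall>P'. P' \<in> I \<and> P' \<subseteq> X \<and> P \<subseteq> P' \<longrightarrow> P' = P)"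

text \<open>The parts \<open>Q\<close> and \<open>Z\<close> may be empty, and they are chosen before the basis \<open>P\<close>.\<close>

definition growth_system :: "nat \<Rightarrow> 'e set \<Rightarrow> 'e set set \<Rightarrow> bool" where
  "growth_system k S I \<longleftrightarrow>
     indep_system S I \<and> 0 < k \<and>
     (\<forall>X I0. X \<subseteq> S \<and> I0 \<in> I \<longrightarrow>
        (\<exists>Q Z. Q \<union> Z = I0 - X \<and> Q \<inter> Z = {} \<and> card Z \<le> k * card (X - I0) \<and>
               (\<forall>P. basis_of I X P \<longrightarrow> P \<union> Q \<in> I)))"

definition matroid :: "'e set \<Rightarrow> 'e set set \<Rightarrow> bool" where
  "matroid S I \<longleftrightarrow>
     indep_system S I \<and>
     (\<forall>X\<in>I. \<forall>Y\<in>I. card X < card Y \<longrightarrow> (\<exists>e\<in>Y - X. insert e X \<in> I))"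

definition combination :: "'i set \<Rightarrow> ('i \<Rightarrow> 'e set) \<Rightarrow> ('i \<Rightarrow> 'e set set) \<Rightarrow> 'e set set" where
  "combination J S I = {X. X \<subseteq> (\<Union>j\<in>J. S j) \<and> (\<forall>j\<in>J. X \<inter> S j \<in> I j)}"

text \<open>
  Edges are pairs of an agent and an item. The map \<open>v\<close> sends an edge to the endpoint
  at which it is considered: \<open>fst\<close> on the agent side and \<open>snd\<close> on the item side.
  Injectivity of \<open>v\<close> on \<open>X\<close> says that each vertex is incident to at most one edge of \<open>X\<close>.
\<close>

definition edge_ground :: "'e set \<Rightarrow> ('e \<Rightarrow> 'v) \<Rightarrow> 'v set \<Rightarrow> 'e set" where
  "edge_ground E v S = {e \<in> E. v e \<in> S}"

definition edge_indep :: "'e set \<Rightarrow> ('e \<Rightarrow> 'v) \<Rightarrow> 'v set \<Rightarrow> 'v set set \<Rightarrow> 'e set set" where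
  "edge_indep E v S J = {X. X \<subseteq> edge_ground E v S \<and> inj_on v X \<and> v ` X \<in> J}"

definition incident :: "('a \<times> 'b) set \<Rightarrow> 'a set \<Rightarrow> ('a \<times> 'b) set" where
  "incident E Y = {e \<in> E. fst e \<in> Y}"

definition phull :: "'e set \<Rightarrow> 'e set set \<Rightarrow> 'e set \<Rightarrow> 'e set" where
  "phull S I X = X \<union> {e \<in> S. \<exists>C. circuit S I C \<and> e \<in> C \<and> C \<subseteq> insert e X}"

definition pcore :: "'e set \<Rightarrow> 'e set set \<Rightarrow> ('e \<Rightarrow> real) \<Rightarrow> 'e set \<Rightarrow> 'e set" where
  "pcore S I w X = {e \<in> X. e \<notin> phull S I {f \<in> X. w e < w f}}"

text \<open>
  Every set intersected below is a subset of \<open>X\<close>; the leading \<open>X\<close> only matters when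
  both index sets are empty, where the bare intersection would be \<open>UNIV\<close>.
\<close>

definition core ::
  "'i set \<Rightarrow> ('i \<Rightarrow> 'e set) \<Rightarrow> ('i \<Rightarrow> 'e set set) \<Rightarrow>
   'j set \<Rightarrow> ('j \<Rightarrow> 'e set) \<Rightarrow> ('j \<Rightarrow> 'e set set) \<Rightarrow> ('e \<Rightarrow> real) \<Rightarrow> 'e set \<Rightarrow> 'e set" where
  "core JA EA IA JB EB IB w X =
     X \<inter> (\<Inter>j\<in>JA. (X - EA j) \<union> pcore (EA j) (IA j) w (X \<inter> EA j))
       \<inter> (\<Inter>j\<in>JB. (X - EB j) \<union> pcore (EB j) (IB j) w (X \<inter> EB j))"

text \<open>The list \<open>sorted_key_list_of_set w X\<close> is meaningful for finite \<open>X\<close> with \<open>w\<close> injective on \<open>X\<close>.\<close>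

definition greedy :: "'e set set \<Rightarrow> ('e \<Rightarrow> real) \<Rightarrow> 'e set \<Rightarrow> 'e set" where
  "greedy I w X =
     fold (\<lambda>e C. if insert e C \<in> I then insert e C else C) (rev (sorted_key_list_of_set w X)) {}"

definition greedy_relevant :: "'e set set \<Rightarrow> ('e \<Rightarrow> real) \<Rightarrow> 'e set \<Rightarrow> 'e \<Rightarrow> bool" where
  "greedy_relevant I w X e \<longleftrightarrow> e \<notin> X \<and> e \<in> greedy I w (insert e X)"

definition top_relevant ::
  "('a \<times> 'b) set \<Rightarrow> ('a \<times> 'b) set set \<Rightarrow> ('a \<times> 'b \<Rightarrow> real) \<Rightarrow> 'a set \<Rightarrow> 'a \<Rightarrow> 'a \<times> 'b \<Rightarrow> bool" where
  "top_relevant E I w Y a e \<longleftrightarrow>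
     is_arg_max w (\<lambda>f. f \<in> incident E {a} \<and> greedy_relevant I w (incident E Y) f) e"

definition rel_edges ::
  "'a set \<Rightarrow> ('a \<times> 'b) set \<Rightarrow> ('a \<times> 'b) set set \<Rightarrow> ('a \<times> 'b \<Rightarrow> real) \<Rightarrow> 'a set \<Rightarrow> ('a \<times> 'b) set" where
  "rel_edges A E I w Y = {e. \<exists>a\<in>A - Y. top_relevant E I w Y a e}"

definition random_subset :: "'a set \<Rightarrow> real \<Rightarrow> 'a set pmf" where
  "random_subset A p = map_pmf (\<lambda>f. {a \<in> A. f a}) (Pi_pmf A False (\<lambda>_. bernoulli_pmf p))"

end

theory Submission
  imports Defs
begin

text \<open>
  Process the edges by decreasing weight and let each agent toss its coin only when its first
  edge arrives that the current greedy solution can accept: with probability \<open>p\<close> the edge joins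
  \<open>Greedy(\<delta>(Y))\<close>, otherwise it joins \<open>Rel(Y)\<close>. Formally, that edge is the edge of \<open>a\<close> in
  \<open>Greedy(\<delta>(Y + a))\<close>, whether or not \<open>a \<in> Y\<close>, and the coin of \<open>a\<close> influences nothing heavier than it.
  Hence the weights of \<open>Rel(Y)\<close> and \<open>Greedy(\<delta>(Y))\<close> have expectations in ratio \<open>(1 - p) : p\<close>, and
  so have the weights of their edges blocked in a component, i.e. lying in the primitive hull of
  the heavier edges of \<open>Rel(Y)\<close> in that component.

  The growth property, applied to the part \<open>T\<close> of \<open>Rel(Y)\<close> above a threshold and to the blocked
  greedy edges above it, puts all the latter into \<open>Z\<close>, so there are at most \<open>k |T|\<close> of them. In a
  matroid they are bounded by the rank of \<open>T\<close>, that is by the number of its edges that are not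
  blocked. Summation over the thresholds turns these counts into weights, and a union bound over
  the components finishes the proof.
\<close>

subsection \<open>Independence systems\<close>

lemma indep_system_subset:
  "indep_system S I \<Longrightarrow> X \<in> I \<Longrightarrow> Y \<subseteq> X \<Longrightarrow> Y \<in> I"
  unfolding indep_system_def by blast

lemma indep_system_empty: "indep_system S I \<Longrightarrow> {} \<in> I"
  unfolding indep_system_def by blast

lemma indep_system_finite: "indep_system S I \<Longrightarrow> finite S"
  unfolding indep_system_def by blast

lemma basis_of_extend:
  assumes "X \<in> I" "X \<subseteq> R" "finite R"
  shows "\<exists>P. basis_of I R P \<and> X \<subseteq> P"
proof -
  let ?U = "{P \<in> I. X \<subseteq> P \<and> P \<subseteq> R}"
  have "finite ?U" using assms(3) by (auto intro: finite_subset[of _ "Pow R"])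
  moreover have "X \<in> ?U" using assms by blast
  ultimately have "\<exists>P\<in>?U. X \<subseteq> P \<and> (\<forall>Q\<in>?U. P \<subseteq> Q \<longrightarrow> P = Q)"
    by (rule finite_has_maximal2)
  then obtain P where P: "P \<in> ?U" "\<forall>Q\<in>?U. P \<subseteq> Q \<longrightarrow> P = Q"
    by (elim bexE conjE)
  then have "P' = P" if "P' \<in> I \<and> P' \<subseteq> R \<and> P \<subseteq> P'" for P'
    using that subset_trans[of X P P'] by auto
  then have "basis_of I R P \<and> X \<subseteq> P"
    unfolding basis_of_def using P(1) by simp
  then show ?thesis by blast
qed

lemma circuit_exists:
  assumes "X \<subseteq> S" "X \<notin> I" "finite S"
  shows "\<exists>C. circuit S I C \<and> C \<subseteq> X"
proof -
  let ?U = "{D. D \<subseteq> X \<and> D \<notin> I}"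
  have "finite X" using assms(1,3) by (rule finite_subset)
  then have "finite ?U" by simp
  moreover have "X \<in> ?U" using assms by blast
  ultimately have "\<exists>C\<in>?U. C \<subseteq> X \<and> (\<forall>D\<in>?U. D \<subseteq> C \<longrightarrow> C = D)"
    by (rule finite_has_minimal2)
  then obtain C where "C \<in> ?U" "\<forall>D\<in>?U. D \<subseteq> C \<longrightarrow> C = D"
    by (elim bexE conjE)
  then have "circuit S I C \<and> C \<subseteq> X" unfolding circuit_def using assms(1) by blast
  then show ?thesis by blast
qed

lemma circuit_remove:
  assumes "circuit S I C" "e \<in> C"
  shows "C - {e} \<in> I"
proof -
  have "C - {e} \<subset> C" using assms(2) by auto
  then show ?thesis using assms(1) unfolding circuit_def by simp
qed

section \<open>Independent sets inside a primitive hull\<close>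

lemma phull_mono: "X \<subseteq> Y \<Longrightarrow> phull S I X \<subseteq> phull S I Y"
  unfolding phull_def by blast

text \<open>Apply the growth property to \<open>R\<close> and \<open>C\<close> and suppose that some
  \<open>e\<close> of \<open>C\<close> lands in \<open>Q\<close>. For a circuit \<open>D\<close>
  through \<open>e\<close> inside \<open>insert e R\<close>, the independent set
  \<open>D - {e}\<close> extends to a basis \<open>P\<close> of \<open>R\<close>, and then
  \<open>P \<union> Q\<close>, hence \<open>D\<close>, would be independent. It is essential that
  \<open>Q\<close> is fixed before the basis is chosen.\<close>

lemma growth_system_card_phull:
  assumes growth: "growth_system k S I" and "C \<in> I" "R \<subseteq> S" "C \<inter> R = {}" "C \<subseteq> phull S I R"
  shows "card C \<le> k * card R"
proof -
  have sys: "indep_system S I" using growth unfolding growth_system_def by blast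
  have finS: "finite S" using sys by (rule indep_system_finite)
  have "finite C" using sys assms(2) finS unfolding indep_system_def
    by (meson PowD finite_subset subsetD)
  obtain Q Z where QZ: "Q \<union> Z = C - R" "card Z \<le> k * card (R - C)"
    and Q: "\<And>P. basis_of I R P \<Longrightarrow> P \<union> Q \<in> I"
    using growth assms(2,3) unfolding growth_system_def by blast
  have "e \<notin> Q" if e: "e \<in> C" for e
  proof
    assume "e \<in> Q"
    obtain D where D: "circuit S I D" "e \<in> D" "D \<subseteq> insert e R"
      using assms(4,5) e unfolding phull_def by auto
    have "D - {e} \<in> I" by (rule circuit_remove[OF D(1,2)])
    then obtain P where P: "basis_of I R P" "D - {e} \<subseteq> P"
      using basis_of_extend[of "D - {e}" I R] D(3) finS assms(3) finite_subset by blast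
    have "D \<subseteq> P \<union> Q" using P(2) \<open>e \<in> Q\<close> by blast
    then have "D \<in> I" using Q[OF P(1)] sys indep_system_subset by blast
    then show False using D(1) unfolding circuit_def by blast
  qed
  then have "C = Z" using QZ(1) assms(4) by blast
  then show ?thesis using QZ(2) assms(4) by (metis Diff_triv inf_commute)
qed

text \<open>A basis \<open>P'\<close> of \<open>R\<close> containing the circuit through
  \<open>e\<close> except for \<open>e\<close> is no larger than \<open>P\<close>. If
  \<open>insert e P\<close> were independent, augmenting \<open>P'\<close> from it would have to use
  \<open>e\<close> and would complete the circuit.\<close>

lemma matroid_basis_insert_phull:
  assumes mat: "matroid S I" and "R \<subseteq> S" and P: "basis_of I R P" and e: "e \<in> phull S I R" "e \<notin> P"
  shows "insert e P \<notin> I"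
proof (cases "e \<in> R")
  case True
  then show ?thesis using P e(2) unfolding basis_of_def by blast
next
  case False
  have sys: "indep_system S I" using mat unfolding matroid_def by blast
  have finR: "finite R" using indep_system_finite[OF sys] assms(2) finite_subset by blast
  obtain D where D: "circuit S I D" "e \<in> D" "D \<subseteq> insert e R"
    using e False unfolding phull_def by blast
  have "D - {e} \<in> I" by (rule circuit_remove[OF D(1,2)])
  then obtain P' where P': "basis_of I R P'" "D - {e} \<subseteq> P'"
    using basis_of_extend[of "D - {e}" I R] D(3) finR by blast
  have sub: "P \<subseteq> R" "P' \<subseteq> R" "P \<in> I" "P' \<in> I" using P P'(1) unfolding basis_of_def by blast+
  have fin: "finite P" "finite P'" using sub finR finite_subset by blast+
  have "\<not> card P < card P'"
  proof
    assume "card P < card P'"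
    then obtain x where "x \<in> P' - P" "insert x P \<in> I"
      using mat sub unfolding matroid_def by blast
    then show False using P sub unfolding basis_of_def by blast
  qed
  show ?thesis
  proof
    assume ins: "insert e P \<in> I"
    have "card P' < card (insert e P)"
      using \<open>\<not> card P < card P'\<close> fin e(2) by simp
    then obtain x where x: "x \<in> insert e P - P'" "insert x P' \<in> I"
      using mat sub ins unfolding matroid_def by blast
    \<comment> \<open>Any other candidate lies in \<open>R\<close> and contradicts the maximality of
      \<open>P'\<close> there.\<close>
    have "x = e"
    proof (rule ccontr)
      assume "x \<noteq> e"
      then have "insert x P' \<subseteq> R" using x sub by blast
      then show False using x P'(1) unfolding basis_of_def by blast
    qed
    then have "D \<subseteq> insert x P'" using P'(2) by blast
    then have "D \<in> I" using x(2) sys indep_system_subset by blast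
    then show False using D(1) unfolding circuit_def by blast
  qed
qed

text \<open>Membership in the core depends only on strictly heavier elements, so the core commutes
  with cutting at a threshold. The strict cut serves the induction for matroid bases; its weak
  variant serves the level sets.\<close>

lemma pcore_heavier:
  "pcore S I w {f \<in> R. \<theta> < w f} = {f \<in> pcore S I w R. \<theta> < (w f :: real)}"
proof -
  have "{f \<in> {f \<in> R. \<theta> < w f}. w e < w f} = {f \<in> R. w e < w f}" if "\<theta> < w e" for e
    using that by auto
  then show ?thesis unfolding pcore_def by auto
qed

lemma pcore_at_least:
  "pcore S I w {f \<in> R. \<theta> \<le> w f} = {f \<in> pcore S I w R. \<theta> \<le> (w f :: real)}"
proof -
  have "{f \<in> {f \<in> R. \<theta> \<le> w f}. w e < w f} = {f \<in> R. w e < w f}" if "\<theta> \<le> w e" for e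
    using that by auto
  then show ?thesis unfolding pcore_def by auto
qed

text \<open>The lightest element of a circuit lies in the primitive hull of the remaining ones.\<close>

lemma pcore_indep:
  assumes sys: "indep_system S I" and "R \<subseteq> S" and inj: "inj_on w R"
  shows "pcore S I w R \<in> I"
proof (rule ccontr)
  let ?N = "pcore S I w R"
  assume "?N \<notin> I"
  moreover have NR: "?N \<subseteq> R" unfolding pcore_def by blast
  ultimately obtain C where C: "circuit S I C" "C \<subseteq> ?N"
    using circuit_exists[of ?N S I] assms(2) indep_system_finite[OF sys] by blast
  have "C \<noteq> {}" using C(1) indep_system_empty[OF sys] unfolding circuit_def by blast
  moreover have "finite C" using C(2) NR assms(2) indep_system_finite[OF sys]
    by (meson finite_subset)
  ultimately obtain m where m: "m \<in> C" "\<And>x. x \<in> C \<Longrightarrow> w m \<le> w x"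
    by (metis arg_min_if_finite(1) arg_min_least)
  have "C \<subseteq> insert m {f \<in> R. w m < w f}"
  proof
    fix x assume x: "x \<in> C"
    then have "x = m \<or> w m < w x" using m inj C(2) NR
      by (metis inj_onD le_less subsetD)
    then show "x \<in> insert m {f \<in> R. w m < w f}" using x C(2) NR by blast
  qed
  then have "m \<in> phull S I {f \<in> R. w m < w f}"
    unfolding phull_def using C m(1) NR assms(2) by blast
  then show False using m(1) C(2) unfolding pcore_def by blast
qed

text \<open>Induction on strict subsets. If \<open>f\<close> is not in the core, the core of the
  elements heavier than \<open>f\<close> is a basis of them, and \<open>f\<close> lies in their
  hull. So \<open>f\<close> cannot be added to that part of the core, let alone to all of
  it.\<close>

lemma matroid_pcore_basis:
  assumes mat: "matroid S I" and "finite R" "R \<subseteq> S" "inj_on w R"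
  shows "basis_of I R (pcore S I w R)"
  using assms(2-4)
proof (induction R rule: finite_psubset_induct)
  case (psubset R)
  let ?N = "pcore S I w R"
  have sys: "indep_system S I" using mat unfolding matroid_def by blast
  have N: "?N \<in> I" "?N \<subseteq> R"
    using pcore_indep[OF sys psubset.prems] unfolding pcore_def by blast+
  have dep: "insert f ?N \<notin> I" if f: "f \<in> R" "f \<notin> ?N" for f
  proof
    assume ins: "insert f ?N \<in> I"
    let ?R = "{g \<in> R. w f < w g}"
    have "?R \<subset> R" using f(1) by blast
    then have bas: "basis_of I ?R (pcore S I w ?R)"
      using psubset.IH psubset.prems by (meson inj_on_subset psubset_imp_subset subset_trans)
    have "f \<in> phull S I ?R" using f unfolding pcore_def by blast
    moreover have "f \<notin> pcore S I w ?R" unfolding pcore_def by blast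
    ultimately have "insert f (pcore S I w ?R) \<notin> I"
      using matroid_basis_insert_phull[OF mat _ bas] psubset.prems(1) by blast
    moreover have "insert f (pcore S I w ?R) \<subseteq> insert f ?N" unfolding pcore_heavier by blast
    ultimately show False using ins sys indep_system_subset by blast
  qed
  show ?case unfolding basis_of_def
  proof (intro conjI allI impI N)
    fix P assume P: "P \<in> I \<and> P \<subseteq> R \<and> ?N \<subseteq> P"
    have "f \<in> ?N" if "f \<in> P" for f
    proof (rule ccontr)
      assume "f \<notin> ?N"
      then have "insert f ?N \<notin> I" using dep that P by blast
      then show False using P that sys indep_system_subset by (metis insert_subset)
    qed
    then show "P = ?N" using P by blast
  qed
qed

text \<open>If \<open>C\<close> were larger, augmentation would add an element of \<open>C\<close>
  to the core; but the core is a basis of \<open>R\<close>, and no hull element outside a basis can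
  be added to it.\<close>

lemma matroid_card_phull:
  assumes mat: "matroid S I" and "R \<subseteq> S" "inj_on w R" "C \<in> I" "C \<subseteq> phull S I R"
  shows "card C \<le> card (pcore S I w R)"
proof (rule ccontr)
  assume "\<not> ?thesis"
  then have less: "card (pcore S I w R) < card C" by simp
  have "finite R"
    using mat assms(2) indep_system_finite finite_subset unfolding matroid_def by blast
  then have bas: "basis_of I R (pcore S I w R)"
    using matroid_pcore_basis[OF mat] assms(2,3) by blast
  then have "pcore S I w R \<in> I" unfolding basis_of_def by blast
  then obtain e where e: "e \<in> C - pcore S I w R" "insert e (pcore S I w R) \<in> I"
    using mat assms(4) less unfolding matroid_def by blast
  then show False using matroid_basis_insert_phull[OF mat assms(2) bas] assms(5) by blast
qed

subsection \<open>Comparing weights through level sets\<close>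

text \<open>A discrete layer-cake argument: subtracting the smallest weight makes the lightest
  elements vanish, which leaves a smaller set for the induction, and the subtracted part is
  \<open>w m\<close> times a level sum.\<close>

lemma sum_mult_nonneg_of_levels:
  fixes w g :: "'e \<Rightarrow> real"
  assumes "finite S" "\<And>x. x \<in> S \<Longrightarrow> 0 \<le> w x"
    and "\<And>\<theta>. 0 < \<theta> \<Longrightarrow> 0 \<le> sum g {x \<in> S. \<theta> \<le> w x}"
  shows "0 \<le> (\<Sum>x\<in>S. g x * w x)"
  using assms
proof (induction S arbitrary: w rule: finite_psubset_induct)
  case (psubset S)
  show ?case
  proof (cases "S = {}")
    case False
    then obtain m where m: "m \<in> S" "\<And>x. x \<in> S \<Longrightarrow> w m \<le> w x"
      using psubset.hyps(1) by (metis arg_min_if_finite(1) arg_min_least)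
    let ?v = "\<lambda>x. w x - w m" and ?S = "{x \<in> S. w m < w x}"
    have "0 \<le> (\<Sum>x\<in>?S. g x * ?v x)"
    proof (rule psubset.IH)
      show "?S \<subset> S" using m(1) by blast
      show "0 \<le> sum g {x \<in> ?S. \<theta> \<le> ?v x}" if "0 < \<theta>" for \<theta>
      proof -
        have "{x \<in> ?S. \<theta> \<le> ?v x} = {x \<in> S. \<theta> + w m \<le> w x}" using that by auto
        moreover have "0 < \<theta> + w m" using that psubset.prems(1)[OF m(1)] by simp
        ultimately show ?thesis using psubset.prems(2) by metis
      qed
    qed auto
    also have "(\<Sum>x\<in>?S. g x * ?v x) = (\<Sum>x\<in>S. g x * ?v x)"
      using m(2) psubset.hyps(1) by (intro sum.mono_neutral_left) (auto simp: less_le)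
    also have "\<dots> = (\<Sum>x\<in>S. g x * w x) - w m * sum g S"
      by (simp add: right_diff_distrib sum_subtractf sum_distrib_left mult.commute)
    \<comment> \<open>Only positive levels are known to have nonnegative sums, so
      \<open>w m = 0\<close> is treated separately; otherwise the level of \<open>w m\<close> is all
      of \<open>S\<close>.\<close>
    also have "\<dots> \<le> (\<Sum>x\<in>S. g x * w x)"
    proof (cases "w m = 0")
      case False
      then have "0 < w m" using psubset.prems(1)[OF m(1)] by simp
      moreover have "{x \<in> S. w m \<le> w x} = S" using m(2) by blast
      ultimately have "0 \<le> sum g S" using psubset.prems(2)[of "w m"] by simp
      then show ?thesis using \<open>0 < w m\<close> by simp
    qed simp
    finally show ?thesis .
  qed simp
qed

lemma sum_le_of_level_cards:
  fixes w :: "'e \<Rightarrow> real" and c :: real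
  assumes "finite S" "finite T" "\<And>x. x \<in> S \<union> T \<Longrightarrow> 0 \<le> w x"
    and "\<And>\<theta>. real (card {x \<in> S. \<theta> \<le> w x}) \<le> c * real (card {x \<in> T. \<theta> \<le> w x})"
  shows "sum w S \<le> c * sum w T"
proof -
  let ?U = "S \<union> T" and ?g = "\<lambda>x. c * of_bool (x \<in> T) - of_bool (x \<in> S) :: real"
  \<comment> \<open>One identity serves twice: with \<open>h\<close> constantly 1 and
    \<open>P\<close> a threshold it yields the level counts, with \<open>P\<close> always true and
    \<open>h = w\<close> the weights.\<close>
  have restrict: "(\<Sum>x\<in>{x \<in> ?U. P x}. ?g x * h x) = c * sum h {x \<in> T. P x} - sum h {x \<in> S. P x}"
    for P h
  proof -
    have "(\<Sum>x\<in>{x \<in> ?U. P x}. of_bool (x \<in> X) * h x) = sum h {x \<in> X. P x}"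
      if "X \<subseteq> ?U" for X
    proof -
      have "(\<Sum>x\<in>{x \<in> ?U. P x}. of_bool (x \<in> X) * h x)
          = (\<Sum>x\<in>{x \<in> X. P x}. of_bool (x \<in> X) * h x)"
        using assms(1,2) that by (intro sum.mono_neutral_right) auto
      also have "\<dots> = sum h {x \<in> X. P x}" by (intro sum.cong) auto
      finally show ?thesis .
    qed
    from this[of T] this[of S] show ?thesis
      by (simp add: left_diff_distrib sum_subtractf sum_distrib_left[symmetric] mult.assoc)
  qed
  have "0 \<le> (\<Sum>x\<in>?U. ?g x * w x)"
  proof (rule sum_mult_nonneg_of_levels)
    show "0 \<le> sum ?g {x \<in> ?U. \<theta> \<le> w x}" for \<theta>
      using restrict[where P = "\<lambda>x. \<theta> \<le> w x" and h = "\<lambda>_. 1"] assms(4)[of \<theta>] by simp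
  qed (use assms in auto)
  then show ?thesis using restrict[where P = "\<lambda>_. True" and h = w] by (simp add: Un_def)
qed

subsection \<open>The greedy algorithm\<close>

lemma (in linorder) sorted_key_list_of_set_insert_inj:
  assumes "inj_on f (insert x A)" "finite A" "x \<notin> A"
  shows "sorted_key_list_of_set f (insert x A) = insort_key f x (sorted_key_list_of_set f A)"
    and "set (sorted_key_list_of_set f A) = A"
proof -
  \<comment> \<open>The key need not be injective on the whole type, so the locale is instantiated
    with exactly the set on which it is.\<close>
  interpret folding_insort_key "(\<le>)" "(<)" "insert x A" f
    by unfold_locales (use assms in auto)
  show "sorted_key_list_of_set f (insert x A) = insort_key f x (sorted_key_list_of_set f A)"
    using sorted_key_list_of_set_insert[of x A] assms by simp
  show "set (sorted_key_list_of_set f A) = A"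
    by (rule set_sorted_key_list_of_set) (use assms(2) in auto)
qed

lemma (in linorder) sorted_key_list_of_set_empty: "sorted_key_list_of_set f {} = []"
proof -
  interpret folding_insort_key "(\<le>)" "(<)" "{}" f by unfold_locales simp
  show ?thesis by (rule sorted_key_list_of_set_empty)
qed

lemma greedy_empty: "greedy I w {} = {}"
  unfolding greedy_def by (simp add: sorted_key_list_of_set_empty)

text \<open>The increasing list is reversed before processing, so its head, the lightest element,
  comes last and sees the finished solution for \<open>X\<close>.\<close>

lemma greedy_insert_min:
  fixes w :: "'e \<Rightarrow> real"
  assumes "finite X" "inj_on w (insert m X)" "m \<notin> X" "\<And>x. x \<in> X \<Longrightarrow> w m < w x"
  shows "greedy I w (insert m X)
    = (let C = greedy I w X in if insert m C \<in> I then insert m C else C)"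
proof -
  note insert_list = sorted_key_list_of_set_insert_inj[OF assms(2,1,3)]
  have "sorted_key_list_of_set w (insert m X) = m # sorted_key_list_of_set w X"
    unfolding insert_list(1) using insert_list(2) assms(4)
    by (intro insort_is_Cons) (auto intro: less_imp_le)
  then show ?thesis unfolding greedy_def by (simp add: Let_def)
qed

text \<open>The third fact replaces the list by a local rule that tests \<open>e\<close> only
  against heavier accepted elements. The induction removes the lightest element, whose late arrival
  cannot affect any other decision.\<close>

lemma greedy_properties:
  fixes w :: "'e \<Rightarrow> real"
  assumes "finite X" "inj_on w X" "{} \<in> I"
  shows greedy_subset: "greedy I w X \<subseteq> X"
    and greedy_indep: "greedy I w X \<in> I"
    and greedy_iff: "e \<in> X \<Longrightarrow>
      e \<in> greedy I w X \<longleftrightarrow> insert e {f \<in> greedy I w X. w e < w f} \<in> I"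
proof -
  have "greedy I w X \<subseteq> X \<and> greedy I w X \<in> I \<and>
    (\<forall>e\<in>X. e \<in> greedy I w X \<longleftrightarrow> insert e {f \<in> greedy I w X. w e < w f} \<in> I)"
    using assms(1,2)
  proof (induction X rule: finite_psubset_induct)
    case (psubset X)
    show ?case
    proof (cases "X = {}")
      case True
      then show ?thesis using assms(3) by (simp add: greedy_empty)
    next
      case False
      then obtain m where m: "m \<in> X" "\<And>x. x \<in> X \<Longrightarrow> w m \<le> w x"
        using psubset.hyps(1) by (metis arg_min_if_finite(1) arg_min_least)
      let ?X = "X - {m}"
      let ?C = "greedy I w ?X"
      have X: "insert m ?X = X" using m(1) by blast
      have less: "w m < w x" if "x \<in> ?X" for x
        using that m psubset.prems by (metis Diff_iff inj_onD insertI1 le_less)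
      have G: "greedy I w X = (if insert m ?C \<in> I then insert m ?C else ?C)"
        using greedy_insert_min[of ?X w m I, unfolded X] psubset.hyps psubset.prems less
        by (simp add: Let_def)
      have "?X \<subset> X" using m(1) by blast
      then have IH: "?C \<subseteq> ?X" "?C \<in> I"
        "\<And>e. e \<in> ?X \<Longrightarrow> e \<in> ?C \<longleftrightarrow> insert e {f \<in> ?C. w e < w f} \<in> I"
        using psubset.IH[of ?X] psubset.prems by (meson inj_on_subset psubset_imp_subset)+
      have heavier: "{f \<in> greedy I w X. w e < w f} = {f \<in> ?C. w e < w f}" if "e \<in> X" for e
        using m(2)[OF that] unfolding G by auto
      have "{f \<in> ?C. w m < w f} = ?C" using IH(1) less by blast
      moreover have "m \<notin> ?C" using IH(1) by blast
      ultimately have "m \<in> greedy I w X \<longleftrightarrow> insert m {f \<in> greedy I w X. w m < w f} \<in> I"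
        using heavier[OF m(1)] G by simp
      moreover have "e \<in> greedy I w X \<longleftrightarrow> insert e {f \<in> greedy I w X. w e < w f} \<in> I"
        if "e \<in> ?X" for e
        using heavier[of e] that IH(3)[OF that] G by auto
      moreover have "greedy I w X \<subseteq> X" "greedy I w X \<in> I"
        using IH(1,2) m(1) unfolding G by auto
      ultimately show ?thesis by blast
    qed
  qed
  then show "greedy I w X \<subseteq> X" "greedy I w X \<in> I"
    "e \<in> X \<Longrightarrow> e \<in> greedy I w X \<longleftrightarrow> insert e {f \<in> greedy I w X. w e < w f} \<in> I"
    by blast+
qed

text \<open>The acceptance rule is a recursion along decreasing weight, here an induction on the
  number of heavier elements, and so has a single solution. Later comparisons of greedy runs only
  need to check this rule.\<close>

lemma greedy_unique:
  fixes w :: "'e \<Rightarrow> real"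
  assumes "finite X" "inj_on w X" "{} \<in> I" "C \<subseteq> X"
    and C: "\<And>e. e \<in> X \<Longrightarrow> e \<in> C \<longleftrightarrow> insert e {f \<in> C. w e < w f} \<in> I"
  shows "C = greedy I w X"
proof -
  note G = greedy_subset[OF assms(1-3)] greedy_iff[OF assms(1-3)]
  have "e \<in> C \<longleftrightarrow> e \<in> greedy I w X" if "e \<in> X" for e
    using that
  proof (induction "card {f \<in> X. w e < w f}" arbitrary: e rule: less_induct)
    case less
    have "f \<in> C \<longleftrightarrow> f \<in> greedy I w X" if f: "f \<in> X" "w e < w f" for f
    proof (rule less.hyps[OF _ f(1)])
      have "{g \<in> X. w f < w g} \<subset> {g \<in> X. w e < w g}" using f by auto
      then show "card {g \<in> X. w f < w g} < card {g \<in> X. w e < w g}"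
        using assms(1) by (intro psubset_card_mono) auto
    qed
    then have "{f \<in> C. w e < w f} = {f \<in> greedy I w X. w e < w f}"
      using assms(4) G(1) by blast
    then show ?case using C[OF less.prems] G(2)[OF less.prems] by simp
  qed
  then show ?thesis using assms(4) G(1) by blast
qed

lemma greedy_heavier:
  fixes w :: "'e \<Rightarrow> real"
  assumes "finite X" "inj_on w X" "{} \<in> I"
  shows "{f \<in> greedy I w X. \<theta> < w f} = greedy I w {f \<in> X. \<theta> < w f}"
proof (rule greedy_unique)
  show "inj_on w {f \<in> X. \<theta> < w f}" using assms(2) by (rule inj_on_subset) blast
  show "{f \<in> greedy I w X. \<theta> < w f} \<subseteq> {f \<in> X. \<theta> < w f}"
    using greedy_subset[OF assms] by blast
  fix e assume e: "e \<in> {f \<in> X. \<theta> < w f}"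
  then have "{f \<in> {f \<in> greedy I w X. \<theta> < w f}. w e < w f} = {f \<in> greedy I w X. w e < w f}"
    by auto
  then show "e \<in> {f \<in> greedy I w X. \<theta> < w f} \<longleftrightarrow>
    insert e {f \<in> {f \<in> greedy I w X. \<theta> < w f}. w e < w f} \<in> I"
    using greedy_iff[OF assms, of e] e by simp
qed (use assms in auto)

text \<open>When \<open>e\<close> is processed, the run on \<open>insert e X\<close> has accepted
  the same elements as the run on \<open>X\<close>, since the two inputs agree above
  \<open>w e\<close>.\<close>

lemma greedy_relevant_iff:
  fixes w :: "'e \<Rightarrow> real"
  assumes "finite X" "inj_on w (insert e X)" "{} \<in> I" "e \<notin> X"
  shows "greedy_relevant I w X e \<longleftrightarrow> insert e {f \<in> greedy I w X. w e < w f} \<in> I"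
proof -
  have "{f \<in> insert e X. w e < w f} = {f \<in> X. w e < w f}" by auto
  then have "{f \<in> greedy I w (insert e X). w e < w f} = {f \<in> greedy I w X. w e < w f}"
    using greedy_heavier[of "insert e X" w I "w e"] greedy_heavier[of X w I "w e"] assms
    by (simp add: inj_on_insert)
  then show ?thesis
    using greedy_iff[of "insert e X" w I e] assms unfolding greedy_relevant_def by simp
qed

subsection \<open>Random subsets\<close>

lemma finite_set_random_subset: "finite A \<Longrightarrow> finite (set_pmf (random_subset A p))"
  unfolding random_subset_def
  by (rule finite_subset[of _ "Pow A"]) auto

lemma integrable_random_subset [simp]:
  fixes f :: "'a set \<Rightarrow> real"
  shows "finite A \<Longrightarrow> integrable (measure_pmf (random_subset A p)) f"
  by (rule integrable_measure_pmf_finite[OF finite_set_random_subset])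

lemma expectation_random_subset_insert:
  fixes f :: "'a set \<Rightarrow> real"
  assumes "finite A" "a \<notin> A" "0 \<le> p" "p \<le> 1"
  shows "measure_pmf.expectation (random_subset (insert a A) p) f
    = p * measure_pmf.expectation (random_subset A p) (\<lambda>Y. f (insert a Y))
      + (1 - p) * measure_pmf.expectation (random_subset A p) f"
proof -
  have restrict: "{x \<in> insert a A. (g(a := b)) x} = (if b then insert a {x \<in> A. g x} else {x \<in> A. g x})"
    for g b using assms(2) by auto
  let ?M = "Pi_pmf A False (\<lambda>_. bernoulli_pmf p)"
  have "random_subset (insert a A) p
      = bind_pmf (bernoulli_pmf p) (\<lambda>b. map_pmf (\<lambda>g. {x \<in> insert a A. (g(a := b)) x}) ?M)"
    unfolding random_subset_def Pi_pmf_insert'[OF assms(1,2)] map_bind_pmf map_return_pmf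
    by (simp only: map_pmf_def)
  also have "\<dots> = bind_pmf (bernoulli_pmf p)
      (\<lambda>b. map_pmf (\<lambda>Y. if b then insert a Y else Y) (random_subset A p))"
    unfolding restrict random_subset_def map_pmf_comp ..
  finally have "random_subset (insert a A) p = \<dots>" .
  then have "measure_pmf.expectation (random_subset (insert a A) p) f
      = (\<Sum>b\<in>UNIV. pmf (bernoulli_pmf p) b *\<^sub>R
          measure_pmf.expectation (map_pmf (\<lambda>Y. if b then insert a Y else Y) (random_subset A p)) f)"
    using finite_set_random_subset[OF assms(1), of p]
    by (simp only:) (intro pmf_expectation_bind, simp_all)
  also have "\<dots> = p * measure_pmf.expectation (map_pmf (insert a) (random_subset A p)) f
      + (1 - p) * measure_pmf.expectation (map_pmf (\<lambda>Y. Y) (random_subset A p)) f"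
    using assms(3,4) by (simp add: UNIV_bool del: integral_map_pmf)
  finally show ?thesis by simp
qed

lemma expectation_random_subset_cong:
  fixes f :: "'a set \<Rightarrow> real"
  assumes "\<And>Y. Y \<subseteq> A \<Longrightarrow> f Y = g Y"
  shows "measure_pmf.expectation (random_subset A p) f = measure_pmf.expectation (random_subset A p) g"
proof -
  have "AE Y in random_subset A p. f Y = g Y"
    unfolding AE_measure_pmf_iff using assms unfolding random_subset_def by auto
  then show ?thesis by (intro integral_cong_AE) auto
qed

lemma expectation_random_subset_mono:
  fixes f :: "'a set \<Rightarrow> real"
  assumes "finite A" "\<And>Y. Y \<subseteq> A \<Longrightarrow> f Y \<le> g Y"
  shows "measure_pmf.expectation (random_subset A p) f \<le> measure_pmf.expectation (random_subset A p) g"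
proof -
  have "AE Y in random_subset A p. f Y \<le> g Y"
    unfolding AE_measure_pmf_iff using assms(2) unfolding random_subset_def by auto
  then show ?thesis using assms(1) by (intro integral_mono_AE) auto
qed

text \<open>Conditioning on all coins except that of \<open>a\<close>, both sides equal
  \<open>p * (1 - p)\<close> times the expectation of \<open>f\<close> over random subsets of
  \<open>A - {a}\<close>.\<close>

lemma expectation_swap_membership:
  fixes f :: "'a set \<Rightarrow> real"
  assumes "finite A" "a \<in> A" "0 \<le> p" "p \<le> 1"
    and f: "\<And>Y. Y \<subseteq> A \<Longrightarrow> a \<notin> Y \<Longrightarrow> f (insert a Y) = f Y"
  shows "p * measure_pmf.expectation (random_subset A p) (\<lambda>Y. of_bool (a \<notin> Y) * f Y)
    = (1 - p) * measure_pmf.expectation (random_subset A p) (\<lambda>Y. of_bool (a \<in> Y) * f Y)"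
proof -
  define A' where "A' = A - {a}"
  let ?E = "measure_pmf.expectation (random_subset A' p)"
  have A: "A = insert a A'" "finite A'" "a \<notin> A'" using assms(1,2) unfolding A'_def by auto
  note split = expectation_random_subset_insert[OF A(2,3) assms(3,4), folded A(1)]
  have "?E (\<lambda>Y. of_bool (a \<notin> Y) * f Y) = ?E f"
    using A(3) by (intro expectation_random_subset_cong) auto
  moreover have "?E (\<lambda>Y. of_bool (a \<in> Y) * f Y) = ?E (\<lambda>_. 0)"
    using A(3) by (intro expectation_random_subset_cong) auto
  moreover have "?E (\<lambda>Y. f (insert a Y)) = ?E f"
    using A by (intro expectation_random_subset_cong f) auto
  ultimately show ?thesis by (simp add: split)
qed

subsection \<open>Greedy with one edge per agent\<close>

text \<open>Both sides of the constraint are merged into one family \<open>F\<close>. Its downward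
  closure and the rule of one edge per agent suffice to tie the coin of an agent to a single
  edge.\<close>

locale agent_greedy =
  fixes A :: "'a set" and E :: "('a \<times> 'b) set" and F :: "('a \<times> 'b) set set"
    and w :: "'a \<times> 'b \<Rightarrow> real"
  assumes finite_A: "finite A" and finite_E: "finite E" and fst_E: "e \<in> E \<Longrightarrow> fst e \<in> A"
    and inj_w: "inj_on w E"
    and empty_F: "{} \<in> F" and subset_F: "X \<in> F \<Longrightarrow> X' \<subseteq> X \<Longrightarrow> X' \<in> F"
    and inj_fst: "X \<in> F \<Longrightarrow> inj_on fst X"
begin

definition G where "G Y = greedy F w (incident E Y)"

lemma finite_incident: "finite (incident E Y)"
  unfolding incident_def using finite_E by simp

lemma inj_on_w: "X \<subseteq> E \<Longrightarrow> inj_on w X"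
  using inj_w inj_on_subset by blast

lemma incident_subset: "incident E Y \<subseteq> E"
  unfolding incident_def by blast

lemmas incident_facts = finite_incident inj_on_w[OF incident_subset] empty_F

lemma G_subset: "G Y \<subseteq> incident E Y"
  unfolding G_def by (rule greedy_subset[OF incident_facts])

lemma G_in_E: "e \<in> G Y \<Longrightarrow> e \<in> E"
  using G_subset incident_subset by blast

lemma G_fst: "e \<in> G Y \<Longrightarrow> fst e \<in> Y"
  using G_subset unfolding incident_def by blast

lemma G_in_F: "G Y \<in> F"
  unfolding G_def by (rule greedy_indep[OF incident_facts])

lemma G_iff: "e \<in> E \<Longrightarrow> fst e \<in> Y \<Longrightarrow> e \<in> G Y \<longleftrightarrow> insert e {f \<in> G Y. w e < w f} \<in> F"
  unfolding G_def by (rule greedy_iff[OF incident_facts]) (simp add: incident_def)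

lemma relevant_iff:
  assumes "e \<in> E" "fst e \<notin> Y"
  shows "greedy_relevant F w (incident E Y) e \<longleftrightarrow> insert e {f \<in> G Y. w e < w f} \<in> F"
  unfolding G_def
proof (rule greedy_relevant_iff[OF finite_incident _ empty_F])
  show "inj_on w (insert e (incident E Y))"
    using assms(1) incident_subset by (intro inj_on_w) blast
  show "e \<notin> incident E Y" using assms(2) unfolding incident_def by simp
qed

text \<open>As long as no edge of \<open>a\<close> fits, the run with \<open>a\<close> makes the
  same decisions as the run without: the part of \<open>G Y\<close> above the threshold already
  satisfies the acceptance rule for the larger edge set.\<close>

lemma G_insert_heavier:
  assumes none: "\<And>f. f \<in> E \<Longrightarrow> fst f = a \<Longrightarrow> \<theta> < w f \<Longrightarrow> insert f {g \<in> G Y. w f < w g} \<notin> F"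
  shows "{f \<in> G (insert a Y). \<theta> < w f} = {f \<in> G Y. \<theta> < w f}"
proof -
  let ?X = "{f \<in> incident E (insert a Y). \<theta> < w f}"
  have "{f \<in> G Y. \<theta> < w f} = greedy F w ?X"
  proof (rule greedy_unique)
    show "inj_on w ?X" using incident_subset by (intro inj_on_w) blast
    show "finite ?X" using finite_incident by simp
    show "{f \<in> G Y. \<theta> < w f} \<subseteq> ?X" using G_subset unfolding incident_def by blast
    fix e assume e: "e \<in> ?X"
    then have E: "e \<in> E" "\<theta> < w e" and "fst e = a \<or> fst e \<in> Y" unfolding incident_def by auto
    have "{f \<in> {f \<in> G Y. \<theta> < w f}. w e < w f} = {f \<in> G Y. w e < w f}" using E(2) by auto
    moreover have "e \<in> G Y \<longleftrightarrow> insert e {f \<in> G Y. w e < w f} \<in> F"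
    proof (cases "fst e \<in> Y")
      case True
      then show ?thesis using G_iff E(1) by blast
    next
      case False
      then show ?thesis using G_fst none E \<open>fst e = a \<or> fst e \<in> Y\<close> by blast
    qed
    ultimately show "e \<in> {f \<in> G Y. \<theta> < w f} \<longleftrightarrow>
        insert e {f \<in> {f \<in> G Y. \<theta> < w f}. w e < w f} \<in> F"
      using E(2) by simp
  qed (rule empty_F)
  also have "\<dots> = {f \<in> G (insert a Y). \<theta> < w f}"
    unfolding G_def by (rule greedy_heavier[OF incident_facts, symmetric])
  finally show ?thesis by simp
qed

text \<open>The first edge of an agent that fits the run without that agent is the one selected when
  the agent is added, because up to that moment both runs coincide.\<close>

lemma G_insert_iff:
  assumes e: "e \<in> E" "fst e \<notin> Y"
  shows "e \<in> G (insert (fst e) Y) \<longleftrightarrow> insert e {g \<in> G Y. w e < w g} \<in> F \<and>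
    (\<forall>f\<in>E. fst f = fst e \<longrightarrow> w e < w f \<longrightarrow> insert f {g \<in> G Y. w f < w g} \<notin> F)"
    (is "_ \<longleftrightarrow> ?rel e \<and> ?top e")
proof -
  have suff: "e \<in> G (insert (fst e) Y)" if "e \<in> E" "?rel e" "?top e" for e
  proof -
    have "{f \<in> G (insert (fst e) Y). w e < w f} = {f \<in> G Y. w e < w f}"
      using that(3) by (intro G_insert_heavier) blast
    then show ?thesis using that G_iff[of e "insert (fst e) Y"] by simp
  qed
  have "?rel e \<and> ?top e" if G: "e \<in> G (insert (fst e) Y)"
  proof -
    let ?U = "{f \<in> E. fst f = fst e \<and> w e < w f \<and> ?rel f}"
    have "?U = {}"
    proof (rule ccontr)
      assume "?U \<noteq> {}"
      moreover have "finite ?U" using finite_E by simp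
      ultimately obtain f where f: "f \<in> ?U" "\<And>g. g \<in> ?U \<Longrightarrow> w g \<le> w f"
        using arg_min_if_finite(1)[of ?U "\<lambda>x. - w x"] arg_min_least[of ?U _ "\<lambda>x. - w x"]
        by (meson neg_le_iff_le)
      have "?top f"
      proof (intro ballI impI notI)
        fix g assume "g \<in> E" "fst g = fst f" "w f < w g" "?rel g"
        then have "g \<in> ?U" using f(1) by auto
        then show False using f(2) \<open>w f < w g\<close> by fastforce
      qed
      then have "f \<in> G (insert (fst e) Y)" using suff[of f] f(1) by simp
      \<comment> \<open>The heaviest fitting edge \<open>f\<close> above \<open>e\<close> would be
        selected as well, giving the agent two edges in an independent set.\<close>
      then have "f = e" using G inj_fst[OF G_in_F] f(1) by (auto dest: inj_onD)
      then show False using f(1) by simp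
    qed
    then have "?top e" by blast
    moreover have "{f \<in> G (insert (fst e) Y). w e < w f} = {f \<in> G Y. w e < w f}"
      using \<open>?top e\<close> by (intro G_insert_heavier) blast
    then have "?rel e" using G G_iff[OF e(1), of "insert (fst e) Y"] by simp
    ultimately show ?thesis by blast
  qed
  then show ?thesis using suff e(1) by blast
qed

text \<open>Relevance of an edge of \<open>a\<close> means fitting the heavier part of
  \<open>G Y\<close>, so the heaviest relevant edge is the one that \<open>G_insert_iff\<close>
  describes.\<close>

lemma top_relevant_iff:
  assumes "a \<notin> Y"
  shows "top_relevant E F w Y a e \<longleftrightarrow> fst e = a \<and> e \<in> G (insert a Y)"
proof -
  have relevant: "f \<in> incident E {a} \<and> greedy_relevant F w (incident E Y) f \<longleftrightarrow>
      f \<in> E \<and> fst f = a \<and> insert f {g \<in> G Y. w f < w g} \<in> F" for f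
    using relevant_iff[of f Y] assms unfolding incident_def by auto
  have "top_relevant E F w Y a e \<longleftrightarrow> e \<in> E \<and> fst e = a \<and> insert e {g \<in> G Y. w e < w g} \<in> F \<and>
      (\<forall>f\<in>E. fst f = a \<longrightarrow> w e < w f \<longrightarrow> insert f {g \<in> G Y. w f < w g} \<notin> F)"
    unfolding top_relevant_def is_arg_max_def relevant by blast
  then show ?thesis
    using G_insert_iff[of e Y] assms G_in_E[of e "insert a Y"] by (cases "e \<in> E \<and> fst e = a") auto
qed

text \<open>For \<open>fst e \<in> Y\<close> the insertion changes nothing, so \<open>G Y\<close>
  satisfies the same formula with the coin of the agent reversed. This symmetry is what the
  expectation argument exploits.\<close>

definition R where "R Y = {e. fst e \<notin> Y \<and> e \<in> G (insert (fst e) Y)}"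

lemma rel_edges_eq: "rel_edges A E F w Y = R Y"
proof -
  have "fst e \<in> A" if "e \<in> R Y" for e using that fst_E G_in_E unfolding R_def by blast
  then show ?thesis unfolding rel_edges_def R_def by (auto simp: top_relevant_iff)
qed

lemma R_subset: "R Y \<subseteq> E"
  unfolding R_def using G_in_E by blast

text \<open>Above \<open>w e\<close> the greedy run ignores the coin of the agent of
  \<open>e\<close>, and so do the selections of other agents. That agent itself contributes nothing
  heavier, its only selected edge being \<open>e\<close>.\<close>

lemma R_insert_heavier:
  assumes a: "fst e \<notin> Y" and e: "e \<in> G (insert (fst e) Y)"
  shows "{f \<in> R (insert (fst e) Y). w e < w f} = {f \<in> R Y. w e < w f}"
proof -
  let ?Y = "insert (fst e) Y"
  have eE: "e \<in> E" using e by (rule G_in_E)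
  have top: "\<And>f. f \<in> E \<Longrightarrow> fst f = fst e \<Longrightarrow> w e < w f \<Longrightarrow> insert f {g \<in> G Y. w f < w g} \<notin> F"
    using G_insert_iff[OF eE a] e by blast
  have heavier: "{g \<in> G ?Y. w f < w g} = {g \<in> G Y. w f < w g}" if "w e < w f" for f
    using top that by (intro G_insert_heavier) force
  have "f \<in> R ?Y \<longleftrightarrow> f \<in> R Y" if f: "w e < w f" for f
  proof (cases "f \<in> E \<and> fst f \<noteq> fst e \<and> fst f \<notin> Y")
    case True
    have "f \<in> G (insert (fst f) ?Y) \<longleftrightarrow> f \<in> G (insert (fst f) Y)"
      using True heavier f by (auto simp: G_insert_iff)
    then show ?thesis using True unfolding R_def by simp
  next
    case False
    have "f \<notin> R Y" if "fst f = fst e"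
    proof
      assume "f \<in> R Y"
      then have "f \<in> G ?Y" using that unfolding R_def by simp
      then have "f = e" using that e inj_fst[OF G_in_F] by (auto dest: inj_onD)
      then show False using f by simp
    qed
    moreover have "f \<in> E \<and> fst f \<notin> Z" if "f \<in> R Z" for Z
      using that R_subset unfolding R_def by blast
    ultimately show ?thesis using False by blast
  qed
  then show ?thesis by blast
qed

subsection \<open>Edges blocked by one component\<close>

text \<open>The hull is formed from \<open>R Y\<close> even when \<open>e\<close> is in
  \<open>G Y\<close>. Thus, for a selected edge, the condition does not depend on the coin of its
  own agent.\<close>

definition blocked where
  "blocked S I Y e \<longleftrightarrow> e \<in> S \<and> e \<in> phull S I {f \<in> R Y \<inter> S. w e < w f}"

text \<open>Both sums are written over the fixed set \<open>E\<close> with a common factor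
  expressing that \<open>e\<close> is selected and satisfies the condition. This factor ignores the
  coin of the agent of \<open>e\<close>, so the two sides can be compared edge by edge.\<close>

lemma expectation_swap:
  assumes p: "0 < p" "p \<le> 1"
    and \<phi>: "\<And>Y e. Y \<subseteq> A \<Longrightarrow> fst e \<notin> Y \<Longrightarrow> e \<in> G (insert (fst e) Y) \<Longrightarrow> \<phi> (insert (fst e) Y) e = \<phi> Y e"
  shows "p * measure_pmf.expectation (random_subset A p) (\<lambda>Y. sum w {e \<in> R Y. \<phi> Y e})
    = (1 - p) * measure_pmf.expectation (random_subset A p) (\<lambda>Y. sum w {e \<in> G Y. \<phi> Y e})"
proof -
  let ?E = "measure_pmf.expectation (random_subset A p)"
  let ?f = "\<lambda>e Y. of_bool (e \<in> G (insert (fst e) Y) \<and> \<phi> Y e) * w e"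
  have "sum w {e \<in> R Y. \<phi> Y e} = (\<Sum>e\<in>E. of_bool (fst e \<notin> Y) * ?f e Y)" for Y
  proof -
    have "sum w {e \<in> R Y. \<phi> Y e} = (\<Sum>e | e \<in> R Y \<and> \<phi> Y e. of_bool (fst e \<notin> Y) * ?f e Y)"
      by (intro sum.cong) (auto simp: R_def)
    also have "\<dots> = (\<Sum>e\<in>E. of_bool (fst e \<notin> Y) * ?f e Y)"
      using finite_E R_subset by (intro sum.mono_neutral_left) (auto simp: R_def)
    finally show ?thesis .
  qed
  moreover have "sum w {e \<in> G Y. \<phi> Y e} = (\<Sum>e\<in>E. of_bool (fst e \<in> Y) * ?f e Y)" for Y
  proof -
    have "sum w {e \<in> G Y. \<phi> Y e} = (\<Sum>e | e \<in> G Y \<and> \<phi> Y e. of_bool (fst e \<in> Y) * ?f e Y)"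
      by (intro sum.cong) (auto simp: G_fst insert_absorb)
    also have "\<dots> = (\<Sum>e\<in>E. of_bool (fst e \<in> Y) * ?f e Y)"
      using finite_E G_in_E by (intro sum.mono_neutral_left) (auto simp: insert_absorb)
    finally show ?thesis .
  qed
  moreover have "p * ?E (\<lambda>Y. of_bool (fst e \<notin> Y) * ?f e Y)
      = (1 - p) * ?E (\<lambda>Y. of_bool (fst e \<in> Y) * ?f e Y)" if "e \<in> E" for e
    using p \<phi> fst_E[OF that] finite_A by (intro expectation_swap_membership) auto
  ultimately show ?thesis using finite_A by (simp add: Bochner_Integration.integral_sum sum_distrib_left)
qed

lemma expectation_R:
  assumes "0 < p" "p \<le> 1"
  shows "p * measure_pmf.expectation (random_subset A p) (\<lambda>Y. sum w (R Y))
    = (1 - p) * measure_pmf.expectation (random_subset A p) (\<lambda>Y. sum w (G Y))"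
  using expectation_swap[OF assms, of "\<lambda>_ _. True"] by simp

lemma expectation_blocked:
  assumes "0 < p" "p \<le> 1"
  shows "p * measure_pmf.expectation (random_subset A p) (\<lambda>Y. sum w {e \<in> R Y. blocked S I Y e})
    = (1 - p) * measure_pmf.expectation (random_subset A p) (\<lambda>Y. sum w {e \<in> G Y. blocked S I Y e})"
proof (rule expectation_swap[OF assms])
  fix Y and e :: "'a \<times> 'b"
  assume "fst e \<notin> Y" "e \<in> G (insert (fst e) Y)"
  then have "{f \<in> R (insert (fst e) Y) \<inter> S. w e < w f} = {f \<in> R Y \<inter> S. w e < w f}"
    using R_insert_heavier by blast
  then show "blocked S I (insert (fst e) Y) e = blocked S I Y e"
    unfolding blocked_def by simp
qed

lemma not_blocked_R: "{e \<in> R Y \<inter> S. \<not> blocked S I Y e} = pcore S I w (R Y \<inter> S)"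
  unfolding blocked_def pcore_def by blast

end

text \<open>A component enters only through its restriction property, so agent-side and item-side
  components are handled by the same argument.\<close>

locale agent_greedy_component = agent_greedy A E F w
  for A :: "'a set" and E :: "('a \<times> 'b) set" and F w +
  fixes S :: "('a \<times> 'b) set" and I :: "('a \<times> 'b) set set"
  assumes S_subset: "S \<subseteq> E" and F_restrict: "X \<in> F \<Longrightarrow> X \<inter> S \<in> I"
    and w_nonneg: "e \<in> E \<Longrightarrow> 0 \<le> w e"
begin

text \<open>These are the hypotheses of the two cardinality bounds at one level. Disjointness holds
  because agents of \<open>G Y\<close> lie in \<open>Y\<close> and agents of \<open>R Y\<close>
  outside; the edges blocking an edge of the level are heavier and hence in
  \<open>T\<close>.\<close>

lemma blocked_G_at_least:
  fixes \<theta> Y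
  defines "C \<equiv> {e \<in> {e \<in> G Y. blocked S I Y e}. \<theta> \<le> w e}" and "T \<equiv> {e \<in> R Y \<inter> S. \<theta> \<le> w e}"
  shows "C \<in> I" "C \<inter> T = {}" "C \<subseteq> phull S I T"
proof -
  have "C = C \<inter> S" unfolding C_def blocked_def by blast
  moreover have "C \<inter> S \<in> I" using G_in_F subset_F[of "G Y" C] unfolding C_def by (intro F_restrict) blast
  ultimately show "C \<in> I" by simp
  show "C \<inter> T = {}" unfolding C_def T_def R_def using G_fst by blast
  show "C \<subseteq> phull S I T"
  proof
    fix e assume e: "e \<in> C"
    then have "{f \<in> R Y \<inter> S. w e < w f} \<subseteq> T" unfolding C_def T_def by auto
    from phull_mono[OF this, of S I] show "e \<in> phull S I T"
      using e unfolding C_def blocked_def by blast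
  qed
qed

lemma finite_G: "finite (G Y)"
  using finite_E G_in_E by (meson finite_subset subsetI)

lemma finite_R: "finite (R Y)"
  using finite_E R_subset finite_subset by blast

lemma blocked_G_growth:
  assumes "growth_system k S I"
  shows "sum w {e \<in> G Y. blocked S I Y e} \<le> real k * sum w (R Y \<inter> S)"
proof (rule sum_le_of_level_cards)
  fix \<theta>
  have "{e \<in> R Y \<inter> S. \<theta> \<le> w e} \<subseteq> S" by blast
  then have "card {e \<in> {e \<in> G Y. blocked S I Y e}. \<theta> \<le> w e} \<le> k * card {e \<in> R Y \<inter> S. \<theta> \<le> w e}"
    by (rule growth_system_card_phull[OF assms blocked_G_at_least(1) _ blocked_G_at_least(2,3)])
  then show "real (card {e \<in> {e \<in> G Y. blocked S I Y e}. \<theta> \<le> w e})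
      \<le> real k * real (card {e \<in> R Y \<inter> S. \<theta> \<le> w e})"
    unfolding of_nat_mult[symmetric] of_nat_le_iff .
qed (use finite_G finite_R G_in_E S_subset w_nonneg in auto)

lemma blocked_G_matroid:
  assumes "matroid S I"
  shows "sum w {e \<in> G Y. blocked S I Y e} \<le> sum w (pcore S I w (R Y \<inter> S))"
proof -
  have pcore: "pcore S I w (R Y \<inter> S) \<subseteq> R Y \<inter> S" unfolding pcore_def by blast
  have "sum w {e \<in> G Y. blocked S I Y e} \<le> 1 * sum w (pcore S I w (R Y \<inter> S))"
  proof (rule sum_le_of_level_cards)
    fix \<theta>
    have "{e \<in> R Y \<inter> S. \<theta> \<le> w e} \<subseteq> S" by blast
    moreover have "inj_on w {e \<in> R Y \<inter> S. \<theta> \<le> w e}" using S_subset by (intro inj_on_w) blast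
    ultimately have "card {e \<in> {e \<in> G Y. blocked S I Y e}. \<theta> \<le> w e}
        \<le> card (pcore S I w {e \<in> R Y \<inter> S. \<theta> \<le> w e})"
      by (rule matroid_card_phull[OF assms _ _ blocked_G_at_least(1,3)])
    then show "real (card {e \<in> {e \<in> G Y. blocked S I Y e}. \<theta> \<le> w e})
        \<le> 1 * real (card {e \<in> pcore S I w (R Y \<inter> S). \<theta> \<le> w e})"
      \<comment> \<open>The core of the level is the level of the core, so the counts bound the
        weight of the unblocked edges of \<open>R Y\<close> alone.\<close>
      unfolding pcore_at_least by simp
  next
    show "finite (pcore S I w (R Y \<inter> S))" using finite_R pcore by (meson finite_Int finite_subset)
    show "0 \<le> w e" if "e \<in> {e \<in> G Y. blocked S I Y e} \<union> pcore S I w (R Y \<inter> S)" for e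
      using that pcore G_in_E S_subset w_nonneg by blast
  qed (simp add: finite_G)
  then show ?thesis by simp
qed

lemma sum_R_split:
  "sum w (R Y \<inter> S) = sum w {e \<in> R Y. blocked S I Y e} + sum w (pcore S I w (R Y \<inter> S))"
proof -
  have "R Y \<inter> S = {e \<in> R Y. blocked S I Y e} \<union> {e \<in> R Y \<inter> S. \<not> blocked S I Y e}"
    unfolding blocked_def by blast
  then have "sum w (R Y \<inter> S) = sum w ({e \<in> R Y. blocked S I Y e} \<union> {e \<in> R Y \<inter> S. \<not> blocked S I Y e})"
    by (rule arg_cong)
  also have "\<dots> = sum w {e \<in> R Y. blocked S I Y e} + sum w {e \<in> R Y \<inter> S. \<not> blocked S I Y e}"
    using finite_R by (intro sum.union_disjoint) auto
  finally show ?thesis unfolding not_blocked_R .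
qed

lemma expectation_blocked_growth:
  assumes "growth_system k S I" "0 < p" "p \<le> 1"
  shows "p * measure_pmf.expectation (random_subset A p) (\<lambda>Y. sum w {e \<in> R Y. blocked S I Y e})
    \<le> (1 - p) * (real k * measure_pmf.expectation (random_subset A p) (\<lambda>Y. sum w (R Y \<inter> S)))"
proof -
  have "measure_pmf.expectation (random_subset A p) (\<lambda>Y. sum w {e \<in> G Y. blocked S I Y e})
    \<le> measure_pmf.expectation (random_subset A p) (\<lambda>Y. real k * sum w (R Y \<inter> S))"
    using finite_A blocked_G_growth[OF assms(1)] by (intro expectation_random_subset_mono)
  then show ?thesis unfolding expectation_blocked[OF assms(2,3)]
    using assms(3) by (intro mult_left_mono) auto
qed

text \<open>The matroid bound gives \<open>p * b \<le> (1 - p) * c\<close> with \<open>c\<close> the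
  unblocked weight only. Adding \<open>(1 - p) * b\<close> to both sides yields
  \<open>b \<le> (1 - p) * (b + c)\<close>, which improves the rate \<open>(1 - p) / p\<close> of
  the growth case to \<open>1 - p\<close>.\<close>

lemma expectation_blocked_matroid:
  assumes "matroid S I" "0 < p" "p \<le> 1"
  shows "measure_pmf.expectation (random_subset A p) (\<lambda>Y. sum w {e \<in> R Y. blocked S I Y e})
    \<le> (1 - p) * measure_pmf.expectation (random_subset A p) (\<lambda>Y. sum w (R Y \<inter> S))"
proof -
  let ?E = "measure_pmf.expectation (random_subset A p)"
  let ?b = "?E (\<lambda>Y. sum w {e \<in> R Y. blocked S I Y e})"
  let ?c = "?E (\<lambda>Y. sum w (pcore S I w (R Y \<inter> S)))"
  have "?E (\<lambda>Y. sum w {e \<in> G Y. blocked S I Y e}) \<le> ?c"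
    using finite_A blocked_G_matroid[OF assms(1)] by (intro expectation_random_subset_mono)
  then have "p * ?b \<le> (1 - p) * ?c" unfolding expectation_blocked[OF assms(2,3)]
    using assms(3) by (intro mult_left_mono) auto
  moreover have "?E (\<lambda>Y. sum w (R Y \<inter> S)) = ?b + ?c"
    unfolding sum_R_split using finite_A by simp
  ultimately show ?thesis by (simp add: algebra_simps)
qed

end

subsection \<open>Combinations on edges\<close>

lemma combination_subset: "X \<in> combination J S I \<Longrightarrow> X \<subseteq> (\<Union>j\<in>J. S j)"
  unfolding combination_def by blast

lemma combination_restrict: "X \<in> combination J S I \<Longrightarrow> j \<in> J \<Longrightarrow> X \<inter> S j \<in> I j"
  unfolding combination_def by blast

lemma combination_downward:
  assumes "\<And>j. j \<in> J \<Longrightarrow> indep_system (S j) (I j)" "X \<in> combination J S I" "X' \<subseteq> X"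
  shows "X' \<in> combination J S I"
  unfolding combination_def
proof (intro CollectI conjI ballI)
  show "X' \<subseteq> (\<Union>j\<in>J. S j)" using combination_subset assms(2,3) by blast
  fix j assume "j \<in> J"
  then show "X' \<inter> S j \<in> I j"
    using assms by (meson Int_mono combination_restrict indep_system_subset subset_refl)
qed

lemma combination_empty:
  assumes "\<And>j. j \<in> J \<Longrightarrow> indep_system (S j) (I j)"
  shows "{} \<in> combination J S I"
  unfolding combination_def using assms indep_system_empty by auto

text \<open>Membership in a component's ground set depends only on the endpoint, so two edges at the
  same vertex meet in a common component, which treats them as parallel.\<close>

lemma combination_edge_inj_on:
  assumes "X \<in> combination J (\<lambda>j. edge_ground E v (VS j)) (\<lambda>j. edge_indep E v (VS j) (JS j))"
  shows "inj_on v X"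
proof (rule inj_onI)
  let ?S = "\<lambda>j. edge_ground E v (VS j)"
  fix e f assume ef: "e \<in> X" "f \<in> X" "v e = v f"
  then obtain j where j: "j \<in> J" "e \<in> ?S j" using combination_subset[OF assms] by blast
  have "f \<in> E" using combination_subset[OF assms] ef(2) unfolding edge_ground_def by blast
  then have "f \<in> ?S j" using j(2) ef(3) unfolding edge_ground_def by simp
  moreover have "inj_on v (X \<inter> ?S j)"
    using combination_restrict[OF assms j(1)] unfolding edge_indep_def by simp
  ultimately show "e = f" using ef j(2) by (auto dest: inj_onD)
qed

section \<open>Union bound over the components\<close>

lemma sum_Un_le:
  fixes w :: "'e \<Rightarrow> real"
  assumes "finite X" "finite Y" "\<And>e. e \<in> X \<inter> Y \<Longrightarrow> 0 \<le> w e"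
  shows "sum w (X \<union> Y) \<le> sum w X + sum w Y"
  using sum_nonneg[of "X \<inter> Y" w] assms by (simp add: sum_Un)

lemma sum_UN_le:
  fixes w :: "'e \<Rightarrow> real"
  assumes "finite J" "\<And>j. j \<in> J \<Longrightarrow> finite (X j)" "\<And>j e. j \<in> J \<Longrightarrow> e \<in> X j \<Longrightarrow> 0 \<le> w e"
  shows "sum w (\<Union>j\<in>J. X j) \<le> (\<Sum>j\<in>J. sum w (X j))"
  using assms
proof (induction J rule: finite_induct)
  case (insert i J)
  have "sum w (X i \<union> (\<Union>j\<in>J. X j)) \<le> sum w (X i) + sum w (\<Union>j\<in>J. X j)"
    using insert.hyps(1) insert.prems by (intro sum_Un_le) auto
  then show ?case using insert.IH insert.hyps insert.prems by force
qed simp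

text \<open>An element of \<open>X\<close> missing from the core is missing from the primitive core
  of some component containing it; elements lost in several components are overcounted.\<close>

lemma sum_le_sum_core:
  fixes w :: "'e \<Rightarrow> real"
  assumes "finite X" "finite JA" "finite JB" "\<And>e. e \<in> X \<Longrightarrow> 0 \<le> w e"
  shows "sum w X \<le> sum w (core JA SA IA JB SB IB w X)
    + (\<Sum>j\<in>JA. sum w (X \<inter> SA j - pcore (SA j) (IA j) w (X \<inter> SA j)))
    + (\<Sum>j\<in>JB. sum w (X \<inter> SB j - pcore (SB j) (IB j) w (X \<inter> SB j)))"
proof -
  let ?C = "core JA SA IA JB SB IB w X"
  let ?A = "\<lambda>j. X \<inter> SA j - pcore (SA j) (IA j) w (X \<inter> SA j)"
  let ?B = "\<lambda>j. X \<inter> SB j - pcore (SB j) (IB j) w (X \<inter> SB j)"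
  have C: "?C \<subseteq> X" unfolding core_def by blast
  have fin: "finite (\<Union>j\<in>JA. ?A j)" "finite (\<Union>j\<in>JB. ?B j)" "finite ?C"
    using assms(1-3) C finite_subset by auto
  have "X \<subseteq> ?C \<union> ((\<Union>j\<in>JA. ?A j) \<union> (\<Union>j\<in>JB. ?B j))" unfolding core_def by blast
  then have "sum w X \<le> sum w (?C \<union> ((\<Union>j\<in>JA. ?A j) \<union> (\<Union>j\<in>JB. ?B j)))"
    using fin C assms(4) by (intro sum_mono2) auto
  also have "\<dots> \<le> sum w ?C + sum w ((\<Union>j\<in>JA. ?A j) \<union> (\<Union>j\<in>JB. ?B j))"
    using fin C assms(4) by (intro sum_Un_le) auto
  also have "sum w ((\<Union>j\<in>JA. ?A j) \<union> (\<Union>j\<in>JB. ?B j)) \<le> sum w (\<Union>j\<in>JA. ?A j) + sum w (\<Union>j\<in>JB. ?B j)"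
    using fin assms(4) by (intro sum_Un_le) auto
  also have "sum w (\<Union>j\<in>JA. ?A j) \<le> (\<Sum>j\<in>JA. sum w (?A j))"
    using assms by (intro sum_UN_le) auto
  also have "sum w (\<Union>j\<in>JB. ?B j) \<le> (\<Sum>j\<in>JB. sum w (?B j))"
    using assms by (intro sum_UN_le) auto
  finally show ?thesis by simp
qed

lemma sum_restrict_components:
  fixes w :: "'e \<Rightarrow> real"
  assumes "finite X" "finite J"
  shows "(\<Sum>j\<in>J. real (c j) * sum w (X \<inter> S j))
    = (\<Sum>e\<in>X. real (\<Sum>j | j \<in> J \<and> e \<in> S j. c j) * w e)"
proof -
  have "(\<Sum>j\<in>J. real (c j) * sum w (X \<inter> S j))
      = (\<Sum>j\<in>J. \<Sum>e\<in>X. if e \<in> S j then real (c j) * w e else 0)"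
    using assms(1) by (auto simp: sum_distrib_left sum.inter_restrict intro!: sum.cong)
  also have "\<dots> = (\<Sum>e\<in>X. \<Sum>j\<in>J. if e \<in> S j then real (c j) * w e else 0)"
    by (rule sum.swap)
  also have "\<dots> = (\<Sum>e\<in>X. real (\<Sum>j | j \<in> J \<and> e \<in> S j. c j) * w e)"
    using assms(2) by (auto simp: sum.inter_filter sum_distrib_right intro!: sum.cong)
  finally show ?thesis .
qed

section \<open>Assembling the bounds of all components\<close>

theorem lemma6:
  fixes A :: "'a set" and B :: "'b set" and E :: "('a \<times> 'b) set"
    and w :: "'a \<times> 'b \<Rightarrow> real"
    and MA MB :: nat
    and AS :: "nat \<Rightarrow> 'a set" and JS :: "nat \<Rightarrow> 'a set set"
    and BS :: "nat \<Rightarrow> 'b set" and LS :: "nat \<Rightarrow> 'b set set"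
    and kA lB :: "nat \<Rightarrow> nat" and k :: nat and p :: real
  defines "EA \<equiv> (\<lambda>j. edge_ground E fst (AS j))"
    and "IA \<equiv> (\<lambda>j. edge_indep E fst (AS j) (JS j))"
    and "EB \<equiv> (\<lambda>j. edge_ground E snd (BS j))"
    and "IB \<equiv> (\<lambda>j. edge_indep E snd (BS j) (LS j))"
  defines "F \<equiv> combination {1..MA} EA IA \<inter> combination {1..MB} EB IB"
    and "Core \<equiv> core {1..MA} EA IA {1..MB} EB IB w"
  assumes "finite A" and "finite B" and "E \<subseteq> A \<times> B"
    and "inj_on w E" and "\<forall>e\<in>E. 0 \<le> w e"
    and "\<forall>j\<in>{1..MA}. indep_system (AS j) (JS j)" and "A = (\<Union>j\<in>{1..MA}. AS j)"
    and "\<forall>j\<in>{1..MB}. indep_system (BS j) (LS j)" and "B = (\<Union>j\<in>{1..MB}. BS j)"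
    and "\<forall>j\<in>{1..MA}. growth_system (kA j) (EA j) (IA j)"
    and "\<forall>j\<in>{1..MB}. growth_system (lB j) (EB j) (IB j)"
    and "k = Max ((\<lambda>e. (\<Sum>j | j \<in> {1..MA} \<and> e \<in> EA j. kA j)
                      + (\<Sum>j | j \<in> {1..MB} \<and> e \<in> EB j. lB j)) ` E)"
    and "0 < p" and "p \<le> 1"
  shows
    "measure_pmf.expectation (random_subset A p) (\<lambda>Y. sum w (Core (rel_edges A E F w Y)))
       \<ge> (p - (1 - p) * real k) * (1 - p) / p\<^sup>2
         * measure_pmf.expectation (random_subset A p) (\<lambda>Y. sum w (greedy F w (incident E Y)))
     \<and>
     ((\<forall>j\<in>{1..MA}. matroid (EA j) (IA j) \<and> kA j = 1) \<and>
      (\<forall>j\<in>{1..MB}. matroid (EB j) (IB j) \<and> lB j = 1) \<longrightarrow>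
      measure_pmf.expectation (random_subset A p) (\<lambda>Y. sum w (Core (rel_edges A E F w Y)))
        \<ge> (p - (1 - p) * (real k - 1)) * (1 - p) / p
          * measure_pmf.expectation (random_subset A p) (\<lambda>Y. sum w (greedy F w (incident E Y))))"
proof -
  let ?E = "measure_pmf.expectation (random_subset A p)"
  have finE: "finite E" using assms(7-9) by (meson finite_SigmaI finite_subset)
  have sysA: "indep_system (EA j) (IA j)" if "j \<in> {1..MA}" for j
    using assms(16) that unfolding growth_system_def by blast
  have sysB: "indep_system (EB j) (IB j)" if "j \<in> {1..MB}" for j
    using assms(17) that unfolding growth_system_def by blast
  interpret agent_greedy A E F w
  proof
    show "finite A" "finite E" "inj_on w E" using assms(7,10) finE by blast+
    show "e \<in> E \<Longrightarrow> fst e \<in> A" for e using assms(9) by auto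
    show "{} \<in> F" unfolding F_def using combination_empty sysA sysB by blast
    show "X' \<in> F" if "X \<in> F" "X' \<subseteq> X" for X X'
    proof -
      have X: "X \<in> combination {1..MA} EA IA" "X \<in> combination {1..MB} EB IB"
        using that(1) unfolding F_def by simp_all
      show ?thesis
        unfolding F_def using combination_downward[OF sysA X(1) that(2)]
          combination_downward[OF sysB X(2) that(2)] by simp
    qed
    show "inj_on fst X" if "X \<in> F" for X
    proof (rule combination_edge_inj_on)
      show "X \<in> combination {1..MA} (\<lambda>j. edge_ground E fst (AS j)) (\<lambda>j. edge_indep E fst (AS j) (JS j))"
        using that unfolding F_def EA_def IA_def by simp
    qed
  qed
  have compA: "agent_greedy_component A E F w (EA j) (IA j)" if "j \<in> {1..MA}" for j
  proof
    show "EA j \<subseteq> E" unfolding EA_def edge_ground_def by blast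
    show "X \<inter> EA j \<in> IA j" if "X \<in> F" for X
      using that \<open>j \<in> {1..MA}\<close> unfolding F_def by (intro combination_restrict) auto
  qed (use assms(11) in blast)
  have compB: "agent_greedy_component A E F w (EB j) (IB j)" if "j \<in> {1..MB}" for j
  proof
    show "EB j \<subseteq> E" unfolding EB_def edge_ground_def by blast
    show "X \<inter> EB j \<in> IB j" if "X \<in> F" for X
      using that \<open>j \<in> {1..MB}\<close> unfolding F_def by (intro combination_restrict) auto
  qed (use assms(11) in blast)

  define r g c where "r = ?E (\<lambda>Y. sum w (R Y))" and "g = ?E (\<lambda>Y. sum w (G Y))"
    and "c = ?E (\<lambda>Y. sum w (Core (R Y)))"
  define lost where "lost S I = ?E (\<lambda>Y. sum w {e \<in> R Y. blocked S I Y e})" for S I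
  have finR: "finite (R Y)" for Y using R_subset finE finite_subset by blast
  have w0: "0 \<le> w e" if "e \<in> R Y" for e Y using that R_subset assms(11) by blast
  \<comment> \<open>The losses in the union bound are exactly the blocked edges.\<close>
  have blocked: "R Y \<inter> S - pcore S I w (R Y \<inter> S) = {e \<in> R Y. blocked S I Y e}" for Y S I
    unfolding not_blocked_R[symmetric] by (auto simp: blocked_def)
  have "r \<le> ?E (\<lambda>Y. sum w (Core (R Y)) + (\<Sum>j\<in>{1..MA}. sum w {e \<in> R Y. blocked (EA j) (IA j) Y e})
      + (\<Sum>j\<in>{1..MB}. sum w {e \<in> R Y. blocked (EB j) (IB j) Y e}))"
    unfolding r_def
  proof (rule expectation_random_subset_mono[OF finite_A])
    fix Y
    show "sum w (R Y) \<le> sum w (Core (R Y)) + (\<Sum>j\<in>{1..MA}. sum w {e \<in> R Y. blocked (EA j) (IA j) Y e})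
      + (\<Sum>j\<in>{1..MB}. sum w {e \<in> R Y. blocked (EB j) (IB j) Y e})"
      unfolding Core_def blocked[symmetric] by (rule sum_le_sum_core) (use finR w0 in auto)
  qed
  also have "\<dots> = c + (\<Sum>j\<in>{1..MA}. lost (EA j) (IA j)) + (\<Sum>j\<in>{1..MB}. lost (EB j) (IB j))"
    unfolding c_def lost_def using finite_A by (simp add: Bochner_Integration.integral_sum)
  finally have r_le: "r \<le> c + (\<Sum>j\<in>{1..MA}. lost (EA j) (IA j)) + (\<Sum>j\<in>{1..MB}. lost (EB j) (IB j))" .

  \<comment> \<open>Double counting: an edge contributes once for each component containing it, with
    the coefficient of that component, and these coefficients add up to at most
    \<open>k\<close>.\<close>
  have components: "(\<Sum>j\<in>{1..MA}. real (kA j) * ?E (\<lambda>Y. sum w (R Y \<inter> EA j)))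
      + (\<Sum>j\<in>{1..MB}. real (lB j) * ?E (\<lambda>Y. sum w (R Y \<inter> EB j))) \<le> real k * r"
  proof -
    have "(\<Sum>j\<in>{1..MA}. real (kA j) * ?E (\<lambda>Y. sum w (R Y \<inter> EA j)))
        + (\<Sum>j\<in>{1..MB}. real (lB j) * ?E (\<lambda>Y. sum w (R Y \<inter> EB j)))
      = ?E (\<lambda>Y. (\<Sum>j\<in>{1..MA}. real (kA j) * sum w (R Y \<inter> EA j))
          + (\<Sum>j\<in>{1..MB}. real (lB j) * sum w (R Y \<inter> EB j)))"
      using finite_A by (simp add: Bochner_Integration.integral_sum)
    also have "\<dots> \<le> ?E (\<lambda>Y. real k * sum w (R Y))"
    proof (rule expectation_random_subset_mono[OF finite_A])
      fix Y
      let ?k = "\<lambda>e. (\<Sum>j | j \<in> {1..MA} \<and> e \<in> EA j. kA j) + (\<Sum>j | j \<in> {1..MB} \<and> e \<in> EB j. lB j)"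
      have "(\<Sum>j\<in>{1..MA}. real (kA j) * sum w (R Y \<inter> EA j))
          + (\<Sum>j\<in>{1..MB}. real (lB j) * sum w (R Y \<inter> EB j)) = (\<Sum>e\<in>R Y. real (?k e) * w e)"
        unfolding sum_restrict_components[OF finR finite_atLeastAtMost]
        by (simp add: sum.distrib distrib_right)
      also have "\<dots> \<le> (\<Sum>e\<in>R Y. real k * w e)"
      proof (intro sum_mono mult_right_mono w0)
        fix e assume "e \<in> R Y"
        \<comment> \<open>For empty \<open>E\<close> the maximum defining \<open>k\<close> has no
          specified value, but here \<open>E\<close> contains \<open>e\<close>.\<close>
        then have "?k e \<in> ?k ` E" using R_subset by blast
        then have "?k e \<le> k" unfolding assms(18) using finE by (intro Max_ge) auto
        then show "real (?k e) \<le> real k" by (rule of_nat_mono)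
      qed
      finally show "(\<Sum>j\<in>{1..MA}. real (kA j) * sum w (R Y \<inter> EA j))
          + (\<Sum>j\<in>{1..MB}. real (lB j) * sum w (R Y \<inter> EB j)) \<le> real k * sum w (R Y)"
        by (simp add: sum_distrib_left)
    qed
    finally show ?thesis unfolding r_def by simp
  qed

  \<comment> \<open>Here \<open>x\<close> is the loss rate common to all components:
    \<open>(1 - p) / p\<close> for growth systems and \<open>1 - p\<close> for matroids.\<close>
  have core_ge: "(1 - x * real k) * r \<le> c" if x: "0 \<le> x"
    and lostA: "\<And>j. j \<in> {1..MA} \<Longrightarrow>
      lost (EA j) (IA j) \<le> x * (real (kA j) * ?E (\<lambda>Y. sum w (R Y \<inter> EA j)))"
    and lostB: "\<And>j. j \<in> {1..MB} \<Longrightarrow>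
      lost (EB j) (IB j) \<le> x * (real (lB j) * ?E (\<lambda>Y. sum w (R Y \<inter> EB j)))" for x
  proof -
    have "(\<Sum>j\<in>{1..MA}. lost (EA j) (IA j)) + (\<Sum>j\<in>{1..MB}. lost (EB j) (IB j))
      \<le> x * ((\<Sum>j\<in>{1..MA}. real (kA j) * ?E (\<lambda>Y. sum w (R Y \<inter> EA j)))
          + (\<Sum>j\<in>{1..MB}. real (lB j) * ?E (\<lambda>Y. sum w (R Y \<inter> EB j))))"
      unfolding distrib_left sum_distrib_left by (intro add_mono sum_mono lostA lostB)
    also have "\<dots> \<le> x * (real k * r)" using components x by (rule mult_left_mono)
    finally show ?thesis using r_le by (simp add: algebra_simps)
  qed

  have r_eq: "r = (1 - p) / p * g"
    using expectation_R[OF assms(19,20)] assms(19) unfolding r_def g_def by (simp add: field_simps)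
  have core_eq: "?E (\<lambda>Y. sum w (Core (rel_edges A E F w Y))) = c"
    unfolding c_def rel_edges_eq ..
  have greedy_eq: "?E (\<lambda>Y. sum w (greedy F w (incident E Y))) = g"
    unfolding g_def G_def ..

  have "(p - (1 - p) * real k) * (1 - p) / p\<^sup>2 * g \<le> c"
  proof -
    have growth: "lost S I \<le> (1 - p) / p * (real n * ?E (\<lambda>Y. sum w (R Y \<inter> S)))"
      if "agent_greedy_component A E F w S I" "growth_system n S I" for S I n
      using agent_greedy_component.expectation_blocked_growth[OF that assms(19,20)] assms(19)
      unfolding lost_def by (simp add: field_simps)
    have "(1 - (1 - p) / p * real k) * r \<le> c"
      using assms(16,17,19,20) compA compB by (intro core_ge growth) auto
    moreover have "(1 - (1 - p) / p * real k) * r = (p - (1 - p) * real k) * (1 - p) / p\<^sup>2 * g"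
      unfolding r_eq using assms(19) by (simp add: field_simps power2_eq_square)
    ultimately show ?thesis by simp
  qed
  moreover have "(p - (1 - p) * (real k - 1)) * (1 - p) / p * g \<le> c"
    if A: "\<forall>j\<in>{1..MA}. matroid (EA j) (IA j) \<and> kA j = 1"
      and B: "\<forall>j\<in>{1..MB}. matroid (EB j) (IB j) \<and> lB j = 1"
  proof -
    have matr: "lost S I \<le> (1 - p) * (real n * ?E (\<lambda>Y. sum w (R Y \<inter> S)))"
      if "agent_greedy_component A E F w S I" "matroid S I" "n = 1" for S I n
      using agent_greedy_component.expectation_blocked_matroid[OF that(1,2) assms(19,20)] that(3)
      unfolding lost_def by simp
    have "(1 - (1 - p) * real k) * r \<le> c"
      using A B assms(20) compA compB by (intro core_ge matr) auto
    \<comment> \<open>The \<open>k - 1\<close> of the matroid bound is only a rewriting of the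
      factor obtained with rate \<open>1 - p\<close>.\<close>
    moreover have "p - (1 - p) * (real k - 1) = 1 - (1 - p) * real k" by (simp add: algebra_simps)
    then have "(1 - (1 - p) * real k) * r = (p - (1 - p) * (real k - 1)) * (1 - p) / p * g"
      unfolding r_eq by simp
    ultimately show ?thesis by simp
  qed
  ultimately show ?thesis unfolding core_eq greedy_eq by blast
qed

end
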